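(* Let $(L,\cdot,[,],\alpha,\beta)$ be a regular transposed BiHom-Poisson algebra over $K$ and $D$ a derivation of $(L,\cdot,\alpha,\beta)$ and $(L,[,],\alpha,\beta)$. Then the 5-tuple $(L,\cdot,[\ ,\ ,\ ],\alpha,\beta)$ is a transposed BiHom-Poisson 3-Lie algebra, where the 3-BiHom-Lie algebra structure is defined by $$[x,y,z]=D(x)\cdot[\beta^{-1}(y),\beta^{-1}(z)]+D(y)\cdot[\alpha^{-1}(z),\alpha\beta^{-2}(x)]+D\alpha^{-1}\beta(z)\cdot[\beta^{-1}(x),\alpha\beta^{-2}(y)].$$
   Context: $K$ is a field of characteristic $0$; all vector spaces and linear maps are over $K$. A BiHom-commutative algebra $(L,\cdot,\alpha,\beta)$ is a vector space $L$ with a bilinear product $\cdot$ and linear maps $\alpha,\beta:L\to L$ such that for all $x,y,z\in L$: $\alpha\circ\beta=\beta\circ\alpha$, $\alpha(x\cdot y)=\alpha(x)\cdot\alpha(y)$, $\beta(x\cdot y)=\beta(x)\cdot\beta(y)$, $\alpha(x)\cdot(y\cdot z)=(x\cdot y)\cdot\beta(z)$, and $\beta(x)\cdot\alpha(y)=\beta(y)\cdot\alpha(x)$. A BiHom-Lie algebra $(L,[,],\alpha,\beta)$ is a vector space $L$ with a bilinear bracket and commuting linear maps $\alpha,\beta:L\to L$ such that for all $x,y,z\in L$: $\alpha([x,y])=[\alpha(x),\alpha(y)]$, $\beta([x,y])=[\beta(x),\beta(y)]$, $[\beta(x),\alpha(y)]=-[\beta(y),\alpha(x)]$, and $[[\beta(x),\alpha(y)],\alpha^2(z)]+[[\beta(y),\alpha(z)],\alpha^2(x)]+[[\beta(z),\alpha(x)],\alpha^2(y)]=0$.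 A transposed BiHom-Poisson algebra is a 5-tuple $(L,\cdot,[,],\alpha,\beta)$ such that $(L,\cdot,\alpha,\beta)$ is a BiHom-commutative algebra, $(L,[,],\alpha,\beta)$ is a BiHom-Lie algebra, and for all $x,y,z\in L$: $2\alpha\beta(x)\cdot[y,z]=[\beta(x)\cdot y,\beta(z)]+[\beta(y),\alpha(x)\cdot z]$. It is regular if $\alpha,\beta$ are invertible. $D:L\to L$ is a derivation of $(L,\cdot,\alpha,\beta)$ and of $(L,[,],\alpha,\beta)$ if it is linear with $D(x\cdot y)=D(x)\cdot y+x\cdot D(y)$ and $D([x,y])=[D(x),y]+[x,D(y)]$ for all $x,y\in L$. A 3-BiHom-Lie algebra $(L,[\ ,\ ,\ ],\alpha,\beta)$ is a vector space $L$ with commuting linear maps $\alpha,\beta:L\to L$ and a trilinear map $[\ ,\ ,\ ]:L\times L\times L\to L$ such that for all $x,y,z,u,v\in L$: (i) $\alpha([x,y,z])=[\alpha(x),\alpha(y),\alpha(z)]$ and $\beta([x,y,z])=[\beta(x),\beta(y),\beta(z)]$; (ii) $[\beta(x),\beta(y),\alpha(z)]=-[\beta(y),\beta(x),\alpha(z)]=-[\beta(x),\beta(z),\alpha(y)]$; (iii) $[\beta^2(u),\beta^2(v),[\beta(x),\beta(y),\alpha(z)]]=[\beta^2(y),\beta^2(z),[\beta(u),\beta(v),\alpha(x)]]-[\beta^2(x),\beta^2(z),[\beta(u),\beta(v),\alpha(y)]]+[\beta^2(x),\beta^2(y),[\beta(u),\beta(v),\alpha(z)]]$. A transposed BiHom-Poisson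 3-Lie algebra is a 5-tuple $(L,\cdot,[\ ,\ ,\ ],\alpha,\beta)$ where $(L,\cdot,\alpha,\beta)$ is a BiHom-commutative algebra, $(L,[\ ,\ ,\ ],\alpha,\beta)$ is a 3-BiHom-Lie algebra, and for all $u,x,y,z\in L$: $3\alpha\beta(u)\cdot[x,y,z]=[\beta(u)\cdot x,\beta(y),\beta(z)]+[\beta(x),\beta(u)\cdot y,\beta(z)]+[\beta(x),\beta(y),\alpha(u)\cdot z]$. *)

theory Defs
  imports Complex_Main
begin

text \<open>
  The underlying vector space is a type 'a with an explicit scalar multiplication
  \<open>scale\<close> by a field 'k of characteristic zero, so that products, brackets and
  structure maps are total functions on 'a.
\<close>

definition bilinear_map ::
  "('k::field_char_0 \<Rightarrow> 'a::ab_group_add \<Rightarrow> 'a) \<Rightarrow> ('a \<Rightarrow> 'a \<Rightarrow> 'a) \<Rightarrow> bool" where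
  "bilinear_map scale m \<longleftrightarrow>
     (\<forall>y. Vector_Spaces.linear scale scale (\<lambda>x. m x y)) \<and>
     (\<forall>x. Vector_Spaces.linear scale scale (\<lambda>y. m x y))"

definition trilinear_map ::
  "('k::field_char_0 \<Rightarrow> 'a::ab_group_add \<Rightarrow> 'a) \<Rightarrow> ('a \<Rightarrow> 'a \<Rightarrow> 'a \<Rightarrow> 'a) \<Rightarrow> bool" where
  "trilinear_map scale t \<longleftrightarrow>
     (\<forall>y z. Vector_Spaces.linear scale scale (\<lambda>x. t x y z)) \<and>
     (\<forall>x z. Vector_Spaces.linear scale scale (\<lambda>y. t x y z)) \<and>
     (\<forall>x y. Vector_Spaces.linear scale scale (\<lambda>z. t x y z))"

locale bihom_space = vector_space scale
  for scale :: "'k::field_char_0 \<Rightarrow> 'a::ab_group_add \<Rightarrow> 'a" +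
  fixes \<alpha> \<beta> :: "'a \<Rightarrow> 'a"
  assumes linear_alpha: "Vector_Spaces.linear scale scale \<alpha>"
    and linear_beta: "Vector_Spaces.linear scale scale \<beta>"
    and alpha_beta_commute: "\<alpha> \<circ> \<beta> = \<beta> \<circ> \<alpha>"

locale bihom_commutative_algebra = bihom_space scale \<alpha> \<beta>
  for scale :: "'k::field_char_0 \<Rightarrow> 'a::ab_group_add \<Rightarrow> 'a"
    and mul :: "'a \<Rightarrow> 'a \<Rightarrow> 'a"
    and \<alpha> \<beta> :: "'a \<Rightarrow> 'a" +
  assumes bilinear_mul: "bilinear_map scale mul"
    and alpha_mul: "\<alpha> (mul x y) = mul (\<alpha> x) (\<alpha> y)"
    and beta_mul: "\<beta> (mul x y) = mul (\<beta> x) (\<beta> y)"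
    and bihom_assoc: "mul (\<alpha> x) (mul y z) = mul (mul x y) (\<beta> z)"
    and bihom_comm: "mul (\<beta> x) (\<alpha> y) = mul (\<beta> y) (\<alpha> x)"

locale bihom_lie_algebra = bihom_space scale \<alpha> \<beta>
  for scale :: "'k::field_char_0 \<Rightarrow> 'a::ab_group_add \<Rightarrow> 'a"
    and br :: "'a \<Rightarrow> 'a \<Rightarrow> 'a"
    and \<alpha> \<beta> :: "'a \<Rightarrow> 'a" +
  assumes bilinear_br: "bilinear_map scale br"
    and alpha_br: "\<alpha> (br x y) = br (\<alpha> x) (\<alpha> y)"
    and beta_br: "\<beta> (br x y) = br (\<beta> x) (\<beta> y)"
    and bihom_skew: "br (\<beta> x) (\<alpha> y) = - br (\<beta> y) (\<alpha> x)"
    and bihom_jacobi: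
      "br (br (\<beta> x) (\<alpha> y)) (\<alpha> (\<alpha> z))
       + br (br (\<beta> y) (\<alpha> z)) (\<alpha> (\<alpha> x))
       + br (br (\<beta> z) (\<alpha> x)) (\<alpha> (\<alpha> y)) = 0"

locale transposed_bihom_poisson_algebra =
  bihom_commutative_algebra scale mul \<alpha> \<beta> + bihom_lie_algebra scale br \<alpha> \<beta>
  for scale :: "'k::field_char_0 \<Rightarrow> 'a::ab_group_add \<Rightarrow> 'a"
    and mul :: "'a \<Rightarrow> 'a \<Rightarrow> 'a"
    and br :: "'a \<Rightarrow> 'a \<Rightarrow> 'a"
    and \<alpha> \<beta> :: "'a \<Rightarrow> 'a" +
  assumes transposed_leibniz:
    "scale 2 (mul (\<alpha> (\<beta> x)) (br y z))
     = br (mul (\<beta> x) y) (\<beta> z) + br (\<beta> y) (mul (\<alpha> x) z)"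

locale regular_transposed_bihom_poisson_algebra =
  transposed_bihom_poisson_algebra scale mul br \<alpha> \<beta>
  for scale :: "'k::field_char_0 \<Rightarrow> 'a::ab_group_add \<Rightarrow> 'a"
    and mul :: "'a \<Rightarrow> 'a \<Rightarrow> 'a"
    and br :: "'a \<Rightarrow> 'a \<Rightarrow> 'a"
    and \<alpha> \<beta> :: "'a \<Rightarrow> 'a" +
  assumes bij_alpha: "bij \<alpha>"
    and bij_beta: "bij \<beta>"

text \<open>A derivation is not required to commute with the structure maps.\<close>

definition derivation_of ::
  "('k::field_char_0 \<Rightarrow> 'a::ab_group_add \<Rightarrow> 'a) \<Rightarrow> ('a \<Rightarrow> 'a \<Rightarrow> 'a) \<Rightarrow> ('a \<Rightarrow> 'a) \<Rightarrow> bool" where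
  "derivation_of scale m D \<longleftrightarrow>
     Vector_Spaces.linear scale scale D \<and> (\<forall>x y. D (m x y) = m (D x) y + m x (D y))"

locale three_bihom_lie_algebra = bihom_space scale \<alpha> \<beta>
  for scale :: "'k::field_char_0 \<Rightarrow> 'a::ab_group_add \<Rightarrow> 'a"
    and tbr :: "'a \<Rightarrow> 'a \<Rightarrow> 'a \<Rightarrow> 'a"
    and \<alpha> \<beta> :: "'a \<Rightarrow> 'a" +
  assumes trilinear_tbr: "trilinear_map scale tbr"
    and alpha_tbr: "\<alpha> (tbr x y z) = tbr (\<alpha> x) (\<alpha> y) (\<alpha> z)"
    and beta_tbr: "\<beta> (tbr x y z) = tbr (\<beta> x) (\<beta> y) (\<beta> z)"
    and tbr_skew_12: "tbr (\<beta> x) (\<beta> y) (\<alpha> z) = - tbr (\<beta> y) (\<beta> x) (\<alpha> z)"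
    and tbr_skew_23: "tbr (\<beta> x) (\<beta> y) (\<alpha> z) = - tbr (\<beta> x) (\<beta> z) (\<alpha> y)"
    and tbr_jacobi:
      "tbr (\<beta> (\<beta> u)) (\<beta> (\<beta> v)) (tbr (\<beta> x) (\<beta> y) (\<alpha> z))
       = tbr (\<beta> (\<beta> y)) (\<beta> (\<beta> z)) (tbr (\<beta> u) (\<beta> v) (\<alpha> x))
         - tbr (\<beta> (\<beta> x)) (\<beta> (\<beta> z)) (tbr (\<beta> u) (\<beta> v) (\<alpha> y))
         + tbr (\<beta> (\<beta> x)) (\<beta> (\<beta> y)) (tbr (\<beta> u) (\<beta> v) (\<alpha> z))"

locale transposed_bihom_poisson_three_lie_algebra =
  bihom_commutative_algebra scale mul \<alpha> \<beta> + three_bihom_lie_algebra scale tbr \<alpha> \<beta>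
  for scale :: "'k::field_char_0 \<Rightarrow> 'a::ab_group_add \<Rightarrow> 'a"
    and mul :: "'a \<Rightarrow> 'a \<Rightarrow> 'a"
    and tbr :: "'a \<Rightarrow> 'a \<Rightarrow> 'a \<Rightarrow> 'a"
    and \<alpha> \<beta> :: "'a \<Rightarrow> 'a" +
  assumes transposed_three_leibniz:
    "scale 3 (mul (\<alpha> (\<beta> u)) (tbr x y z))
     = tbr (mul (\<beta> u) x) (\<beta> y) (\<beta> z)
       + tbr (\<beta> x) (mul (\<beta> u) y) (\<beta> z)
       + tbr (\<beta> x) (\<beta> y) (mul (\<alpha> u) z)"

end

theory Submission
  imports Defs
begin

text \<open>
\<^bold>\<open>Untwisting.\<close> When the structure maps are invertible, the products
\<open>x \<odot> y = \<alpha>\<inverse> x \<cdot> \<beta>\<inverse> y\<close> and \<open>\<lbrace>x, y\<rbrace> = [\<alpha>\<inverse> x, \<beta>\<inverse> y]\<close> form an ordinary transposed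
Poisson algebra on which \<open>\<alpha>\<close> and \<open>\<beta>\<close> act as commuting automorphisms, and the ternary bracket
of the theorem becomes \<open>W(\<alpha> x, \<alpha> y, \<beta> z)\<close> with the alternating expression
\<open>W(x, y, z) = d x \<odot> \<lbrace>y, z\<rbrace> + d y \<odot> \<lbrace>z, x\<rbrace> + d z \<odot> \<lbrace>x, y\<rbrace>\<close>, \<open>d = \<alpha> D \<alpha>\<inverse>\<close>. The identities of a
3-BiHom-Lie algebra for the former are the identities of a 3-Lie algebra for the latter,
as soon as \<open>W\<close> is invariant under \<open>\<alpha>\<close> and \<open>\<beta>\<close>.

\<^bold>\<open>A derivation that need not commute with the structure maps.\<close> For the untwisted products
\<open>D\<close> only satisfies \<open>D (x \<odot> y) = \<alpha> D \<alpha>\<inverse> x \<odot> y + x \<odot> \<beta> D \<beta>\<inverse> y\<close>, and likewise for the bracket.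
Symmetrizing both products yields maps \<open>S 0 = D\<close>,
\<open>S (n + 1) = (\<alpha> S n \<alpha>\<inverse> + \<beta> S n \<beta>\<inverse>) / 2\<close> with
\<open>S n (x \<odot> y) = S (n + 1) x \<odot> y + x \<odot> S (n + 1) y\<close>. Three facts replace the missing
commutation. The maps \<open>\<alpha> S n \<alpha>\<inverse>\<close>, \<open>\<beta> S n \<beta>\<inverse>\<close> and \<open>S (n + 1)\<close> produce the same \<open>W\<close>
(\<open>wronskian_cong_twist\<close>); applying \<open>S n\<close> to the transposed Leibniz rule shows that \<open>S (n + 1)\<close>
and \<open>S (n + 2)\<close> produce the same \<open>W\<close> (\<open>wronskian_S_Suc\<close>), so that \<open>W\<close> is invariant; and
applying \<open>S n\<close> to the associative law gives
\<open>F a \<odot> b \<odot> c = a \<odot> b \<odot> F c\<close> for \<open>F = S (n + 1) - S (n + 2)\<close> (\<open>S_diff_mul_exchange\<close>).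

\<^bold>\<open>The 3-Lie identity.\<close> Expand \<open>W(u, v, W(x, y, z))\<close>. Terms in which \<open>d\<close> is applied once to each of
two letters cancel for every map \<open>d\<close>, by identities that hold in all transposed Poisson algebras
(\<open>first_order_cancels\<close>). Terms \<open>\<lbrace>u, v\<rbrace> \<odot> e x \<odot> \<lbrace>y, z\<rbrace>\<close> also cancel for every map \<open>e\<close>
(\<open>second_order_cancels\<close>); these absorb the iterated derivatives, and, by the exchange law for
\<open>F\<close>, the error made by treating the maps \<open>S n\<close> with different \<open>n\<close> as equal (\<open>S_wronskian\<close>).
\<close>

section \<open>Identities in transposed Poisson rings\<close>

locale transposed_poisson_ring =
  fixes mul :: "'a::ab_group_add \<Rightarrow> 'a \<Rightarrow> 'a" (infixl "\<odot>" 70)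
    and br :: "'a \<Rightarrow> 'a \<Rightarrow> 'a" ("\<lbrace>_,/ _\<rbrace>")
  assumes two_torsion_free: "x + x = 0 \<Longrightarrow> x = 0"
    and mul_add_left: "(x + y) \<odot> z = x \<odot> z + y \<odot> z"
    and mul_commute: "x \<odot> y = y \<odot> x"
    and mul_assoc: "x \<odot> y \<odot> z = x \<odot> (y \<odot> z)"
    and br_add_left: "\<lbrace>x + y, z\<rbrace> = \<lbrace>x, z\<rbrace> + \<lbrace>y, z\<rbrace>"
    and br_skew: "\<lbrace>x, y\<rbrace> = - \<lbrace>y, x\<rbrace>"
    and br_jacobi: "\<lbrace>\<lbrace>x, y\<rbrace>, z\<rbrace> + \<lbrace>\<lbrace>y, z\<rbrace>, x\<rbrace> + \<lbrace>\<lbrace>z, x\<rbrace>, y\<rbrace> = 0"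
    and leibniz: "x \<odot> \<lbrace>y, z\<rbrace> + x \<odot> \<lbrace>y, z\<rbrace> = \<lbrace>x \<odot> y, z\<rbrace> + \<lbrace>y, x \<odot> z\<rbrace>"
begin

lemma double_cancel: "x + x = y + y \<Longrightarrow> x = y" for x y :: 'a
  using two_torsion_free[of "x - y"] by (simp add: algebra_simps)

lemma mul_left_commute: "x \<odot> (y \<odot> z) = y \<odot> (x \<odot> z)"
  by (metis mul_assoc mul_commute)

lemmas mul_ac = mul_assoc mul_commute mul_left_commute

lemma mul_add_right: "x \<odot> (y + z) = x \<odot> y + x \<odot> z"
  by (metis mul_add_left mul_commute)

lemma br_add_right: "\<lbrace>x, y + z\<rbrace> = \<lbrace>x, y\<rbrace> + \<lbrace>x, z\<rbrace>"
  using br_skew[of x] br_add_left[of y z x] by simp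

lemma
  shows mul_minus_left: "- x \<odot> y = - (x \<odot> y)"
    and mul_minus_right: "x \<odot> - y = - (x \<odot> y)"
    and br_minus_left: "\<lbrace>- x, y\<rbrace> = - \<lbrace>x, y\<rbrace>"
    and br_minus_right: "\<lbrace>x, - y\<rbrace> = - \<lbrace>x, y\<rbrace>"
proof -
  have "additive (\<lambda>x. x \<odot> y)" "additive (\<lambda>y. x \<odot> y)" "additive (\<lambda>x. \<lbrace>x, y\<rbrace>)" "additive (\<lambda>y. \<lbrace>x, y\<rbrace>)"
    by (simp_all add: additive_def mul_add_left mul_add_right br_add_left br_add_right)
  then show "- x \<odot> y = - (x \<odot> y)" "x \<odot> - y = - (x \<odot> y)" "\<lbrace>- x, y\<rbrace> = - \<lbrace>x, y\<rbrace>" "\<lbrace>x, - y\<rbrace> = - \<lbrace>x, y\<rbrace>"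
    using additive.minus by fastforce+
qed

lemma mul_zero_right: "x \<odot> 0 = 0"
  using mul_add_right[of x 0 0] by simp

lemma
  shows mul_diff_left: "(x - y) \<odot> z = x \<odot> z - y \<odot> z"
    and mul_diff_right: "x \<odot> (y - z) = x \<odot> y - x \<odot> z"
    and br_diff_left: "\<lbrace>x - y, z\<rbrace> = \<lbrace>x, z\<rbrace> - \<lbrace>y, z\<rbrace>"
    and br_diff_right: "\<lbrace>x, y - z\<rbrace> = \<lbrace>x, y\<rbrace> - \<lbrace>x, z\<rbrace>"
  by (simp_all add: diff_conv_add_uminus mul_add_left mul_add_right br_add_left br_add_right
        mul_minus_left mul_minus_right br_minus_left br_minus_right del: add_uminus_conv_diff)

lemmas distribs = mul_add_left mul_add_right br_add_left br_add_right
  mul_minus_left mul_minus_right br_minus_left br_minus_right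
  mul_diff_left mul_diff_right br_diff_left br_diff_right

text \<open>
In the sum of the transposed Leibniz rule over the cyclic permutations of \<open>x, y, z\<close>, skew
symmetry cancels the six brackets in pairs.
\<close>

lemma mul_br_cyclic: "x \<odot> \<lbrace>y, z\<rbrace> + y \<odot> \<lbrace>z, x\<rbrace> + z \<odot> \<lbrace>x, y\<rbrace> = 0"
proof (rule two_torsion_free)
  have "\<lbrace>x \<odot> y, z\<rbrace> + \<lbrace>y, x \<odot> z\<rbrace> + (\<lbrace>y \<odot> z, x\<rbrace> + \<lbrace>z, y \<odot> x\<rbrace>) + (\<lbrace>z \<odot> x, y\<rbrace> + \<lbrace>x, z \<odot> y\<rbrace>) = 0"
    using br_skew[of y "x \<odot> z"] br_skew[of z "y \<odot> x"] br_skew[of x "z \<odot> y"]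
    by (simp add: mul_commute)
  then show "x \<odot> \<lbrace>y, z\<rbrace> + y \<odot> \<lbrace>z, x\<rbrace> + z \<odot> \<lbrace>x, y\<rbrace> + (x \<odot> \<lbrace>y, z\<rbrace> + y \<odot> \<lbrace>z, x\<rbrace> + z \<odot> \<lbrace>x, y\<rbrace>) = 0"
    unfolding leibniz[symmetric] by (simp add: algebra_simps)
qed

text \<open>
Multiplying the transposed Leibniz rule for \<open>v\<close> by \<open>u\<close> and applying the rule again produces these
two brackets together with the expansion of \<open>(u \<odot> v) \<odot> \<lbrace>x, y\<rbrace>\<close>.
\<close>

lemma leibniz2:
  "u \<odot> v \<odot> \<lbrace>x, y\<rbrace> + u \<odot> v \<odot> \<lbrace>x, y\<rbrace> = \<lbrace>u \<odot> x, v \<odot> y\<rbrace> + \<lbrace>v \<odot> x, u \<odot> y\<rbrace>"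
proof -
  have "u \<odot> (v \<odot> \<lbrace>x, y\<rbrace> + v \<odot> \<lbrace>x, y\<rbrace>) + u \<odot> (v \<odot> \<lbrace>x, y\<rbrace> + v \<odot> \<lbrace>x, y\<rbrace>)
      = \<lbrace>u \<odot> (v \<odot> x), y\<rbrace> + \<lbrace>v \<odot> x, u \<odot> y\<rbrace> + (\<lbrace>u \<odot> x, v \<odot> y\<rbrace> + \<lbrace>x, u \<odot> (v \<odot> y)\<rbrace>)"
    unfolding leibniz[of v] mul_add_right
    using leibniz[of u "v \<odot> x" y] leibniz[of u x "v \<odot> y"] by (simp add: algebra_simps)
  moreover have "u \<odot> v \<odot> \<lbrace>x, y\<rbrace> + u \<odot> v \<odot> \<lbrace>x, y\<rbrace> = \<lbrace>u \<odot> (v \<odot> x), y\<rbrace> + \<lbrace>x, u \<odot> (v \<odot> y)\<rbrace>"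
    using leibniz[of "u \<odot> v" x y] by (simp add: mul_assoc)
  ultimately show ?thesis
    by (simp add: algebra_simps mul_assoc mul_add_right)
qed

text \<open>
Write \<open>P\<close> for the left-hand side and \<open>Q\<close> for the cyclic sum of \<open>\<lbrace>\<lbrace>x, y\<rbrace>, h \<odot> z\<rbrace>\<close>. The Jacobi
identity multiplied by \<open>h\<close> gives \<open>P + Q = 0\<close>; the three Jacobi identities in which one letter
is multiplied by \<open>h\<close> add up to \<open>2 P + Q = 0\<close>.
\<close>

lemma br_mul_br_cyclic:
  "\<lbrace>h \<odot> \<lbrace>x, y\<rbrace>, z\<rbrace> + \<lbrace>h \<odot> \<lbrace>y, z\<rbrace>, x\<rbrace> + \<lbrace>h \<odot> \<lbrace>z, x\<rbrace>, y\<rbrace> = 0"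
proof -
  let ?P = "\<lbrace>h \<odot> \<lbrace>x, y\<rbrace>, z\<rbrace> + \<lbrace>h \<odot> \<lbrace>y, z\<rbrace>, x\<rbrace> + \<lbrace>h \<odot> \<lbrace>z, x\<rbrace>, y\<rbrace>"
  let ?Q = "\<lbrace>\<lbrace>x, y\<rbrace>, h \<odot> z\<rbrace> + \<lbrace>\<lbrace>y, z\<rbrace>, h \<odot> x\<rbrace> + \<lbrace>\<lbrace>z, x\<rbrace>, h \<odot> y\<rbrace>"
  let ?J = "\<lbrace>\<lbrace>x, y\<rbrace>, z\<rbrace> + \<lbrace>\<lbrace>y, z\<rbrace>, x\<rbrace> + \<lbrace>\<lbrace>z, x\<rbrace>, y\<rbrace>"
  have "?P + ?Q = h \<odot> ?J + h \<odot> ?J"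
    using leibniz[of h "\<lbrace>x, y\<rbrace>" z] leibniz[of h "\<lbrace>y, z\<rbrace>" x] leibniz[of h "\<lbrace>z, x\<rbrace>" y]
    by (simp add: mul_add_right add_ac)
  then have PQ: "?P + ?Q = 0"
    by (simp add: br_jacobi mul_zero_right)
  have "\<lbrace>\<lbrace>h \<odot> x, y\<rbrace> + \<lbrace>x, h \<odot> y\<rbrace>, z\<rbrace> + \<lbrace>\<lbrace>h \<odot> y, z\<rbrace> + \<lbrace>y, h \<odot> z\<rbrace>, x\<rbrace>
      + \<lbrace>\<lbrace>h \<odot> z, x\<rbrace> + \<lbrace>z, h \<odot> x\<rbrace>, y\<rbrace> + ?Q
      = (\<lbrace>\<lbrace>h \<odot> x, y\<rbrace>, z\<rbrace> + \<lbrace>\<lbrace>y, z\<rbrace>, h \<odot> x\<rbrace> + \<lbrace>\<lbrace>z, h \<odot> x\<rbrace>, y\<rbrace>)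
      + (\<lbrace>\<lbrace>h \<odot> y, z\<rbrace>, x\<rbrace> + \<lbrace>\<lbrace>z, x\<rbrace>, h \<odot> y\<rbrace> + \<lbrace>\<lbrace>x, h \<odot> y\<rbrace>, z\<rbrace>)
      + (\<lbrace>\<lbrace>h \<odot> z, x\<rbrace>, y\<rbrace> + \<lbrace>\<lbrace>x, y\<rbrace>, h \<odot> z\<rbrace> + \<lbrace>\<lbrace>y, h \<odot> z\<rbrace>, x\<rbrace>)"
    by (simp add: br_add_left add_ac)
  then have "?P + ?P + ?Q = 0"
    unfolding br_jacobi leibniz[symmetric] by (simp add: br_add_left add_ac)
  with PQ show ?thesis
    by (simp add: add.assoc)
qed

text \<open>
The transposed Leibniz rule turns twice the left-hand side into a sum of brackets
\<open>\<lbrace>\<lbrace>h, x\<rbrace> \<odot> y - \<lbrace>h, y\<rbrace> \<odot> x, z\<rbrace>\<close>; by \<open>mul_br_cyclic\<close> the first entries are \<open>- h \<odot> \<lbrace>x, y\<rbrace>\<close>,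
and \<open>br_mul_br_cyclic\<close> applies.
\<close>

lemma br_times_br_cyclic:
  "\<lbrace>h, x\<rbrace> \<odot> \<lbrace>y, z\<rbrace> + \<lbrace>h, y\<rbrace> \<odot> \<lbrace>z, x\<rbrace> + \<lbrace>h, z\<rbrace> \<odot> \<lbrace>x, y\<rbrace> = 0"
proof (rule two_torsion_free)
  let ?S = "\<lbrace>h, x\<rbrace> \<odot> \<lbrace>y, z\<rbrace> + \<lbrace>h, y\<rbrace> \<odot> \<lbrace>z, x\<rbrace> + \<lbrace>h, z\<rbrace> \<odot> \<lbrace>x, y\<rbrace>"
  have M: "\<lbrace>h, x\<rbrace> \<odot> y - \<lbrace>h, y\<rbrace> \<odot> x = - (h \<odot> \<lbrace>x, y\<rbrace>)" for x y
    using mul_br_cyclic[of h x y] br_skew[of y h]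
    by (simp add: mul_commute mul_minus_left mul_minus_right algebra_simps eq_neg_iff_add_eq_0)
  have "?S + ?S = (\<lbrace>\<lbrace>h, x\<rbrace> \<odot> y, z\<rbrace> + \<lbrace>y, \<lbrace>h, x\<rbrace> \<odot> z\<rbrace>) + (\<lbrace>\<lbrace>h, y\<rbrace> \<odot> z, x\<rbrace> + \<lbrace>z, \<lbrace>h, y\<rbrace> \<odot> x\<rbrace>)
      + (\<lbrace>\<lbrace>h, z\<rbrace> \<odot> x, y\<rbrace> + \<lbrace>x, \<lbrace>h, z\<rbrace> \<odot> y\<rbrace>)"
    unfolding leibniz[symmetric] by (simp add: add_ac)
  also have "\<dots> = \<lbrace>\<lbrace>h, x\<rbrace> \<odot> y - \<lbrace>h, y\<rbrace> \<odot> x, z\<rbrace> + \<lbrace>\<lbrace>h, y\<rbrace> \<odot> z - \<lbrace>h, z\<rbrace> \<odot> y, x\<rbrace>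
      + \<lbrace>\<lbrace>h, z\<rbrace> \<odot> x - \<lbrace>h, x\<rbrace> \<odot> z, y\<rbrace>"
    using br_skew[of y "\<lbrace>h, x\<rbrace> \<odot> z"] br_skew[of z "\<lbrace>h, y\<rbrace> \<odot> x"] br_skew[of x "\<lbrace>h, z\<rbrace> \<odot> y"]
    by (simp add: br_diff_left algebra_simps)
  also have "\<dots> = 0"
    unfolding M br_minus_left using br_mul_br_cyclic[of h x y z]
    by (metis add.inverse_neutral minus_add_distrib)
  finally show "?S + ?S = 0" .
qed

text \<open>
Both sides, doubled, equal \<open>\<lbrace>m \<odot> s, r \<odot> z\<rbrace> - \<lbrace>m \<odot> r, s \<odot> z\<rbrace>\<close>. In the 3-Lie identity, this is the
part in which the derivatives fall on two of \<open>x, y, z\<close>, with \<open>m = \<lbrace>u, v\<rbrace>\<close>.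
\<close>

lemma mul_br_exchange:
  "m \<odot> (r \<odot> \<lbrace>s, z\<rbrace> - s \<odot> \<lbrace>r, z\<rbrace>) = s \<odot> \<lbrace>z, r \<odot> m\<rbrace> - r \<odot> \<lbrace>z, s \<odot> m\<rbrace>"
proof (rule double_cancel)
  have "m \<odot> (r \<odot> \<lbrace>s, z\<rbrace> - s \<odot> \<lbrace>r, z\<rbrace>) + m \<odot> (r \<odot> \<lbrace>s, z\<rbrace> - s \<odot> \<lbrace>r, z\<rbrace>)
      = (m \<odot> r \<odot> \<lbrace>s, z\<rbrace> + m \<odot> r \<odot> \<lbrace>s, z\<rbrace>) - (m \<odot> s \<odot> \<lbrace>r, z\<rbrace> + m \<odot> s \<odot> \<lbrace>r, z\<rbrace>)"
    by (simp add: mul_diff_right mul_assoc)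
  also have "\<dots> = \<lbrace>m \<odot> s, r \<odot> z\<rbrace> - \<lbrace>m \<odot> r, s \<odot> z\<rbrace>"
    unfolding leibniz2 by (simp add: mul_commute)
  also have "\<dots> = (\<lbrace>s \<odot> z, r \<odot> m\<rbrace> + \<lbrace>z, s \<odot> (r \<odot> m)\<rbrace>) - (\<lbrace>r \<odot> z, s \<odot> m\<rbrace> + \<lbrace>z, r \<odot> (s \<odot> m)\<rbrace>)"
    unfolding br_skew[of "s \<odot> z"] br_skew[of "r \<odot> z"] by (simp add: mul_commute mul_left_commute)
  also have "\<dots> = s \<odot> \<lbrace>z, r \<odot> m\<rbrace> - r \<odot> \<lbrace>z, s \<odot> m\<rbrace> + (s \<odot> \<lbrace>z, r \<odot> m\<rbrace> - r \<odot> \<lbrace>z, s \<odot> m\<rbrace>)"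
    unfolding leibniz[symmetric] by simp
  finally show "m \<odot> (r \<odot> \<lbrace>s, z\<rbrace> - s \<odot> \<lbrace>r, z\<rbrace>) + m \<odot> (r \<odot> \<lbrace>s, z\<rbrace> - s \<odot> \<lbrace>r, z\<rbrace>) = \<dots>" .
qed

text \<open>
The previous exchange with \<open>m = \<lbrace>y, z\<rbrace>\<close>, one of its terms being rewritten by
\<open>br_mul_br_cyclic\<close>. In the 3-Lie identity, this is the part in which one derivative falls on
\<open>u\<close> or \<open>v\<close> and the other on one of \<open>x, y, z\<close>.
\<close>

lemma mul_br_exchange_jacobi:
  "p \<odot> \<lbrace>v, r \<odot> \<lbrace>y, z\<rbrace>\<rbrace> + r \<odot> \<lbrace>z, p \<odot> \<lbrace>v, y\<rbrace>\<rbrace> + r \<odot> \<lbrace>y, p \<odot> \<lbrace>z, v\<rbrace>\<rbrace>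
   = \<lbrace>y, z\<rbrace> \<odot> (r \<odot> \<lbrace>p, v\<rbrace> - p \<odot> \<lbrace>r, v\<rbrace>)"
proof -
  have "\<lbrace>z, p \<odot> \<lbrace>v, y\<rbrace>\<rbrace> + \<lbrace>y, p \<odot> \<lbrace>z, v\<rbrace>\<rbrace> = - \<lbrace>v, p \<odot> \<lbrace>y, z\<rbrace>\<rbrace>"
    unfolding br_skew[of z "p \<odot> \<lbrace>v, y\<rbrace>"] br_skew[of y "p \<odot> \<lbrace>z, v\<rbrace>"] br_skew[of v "p \<odot> \<lbrace>y, z\<rbrace>"]
    using br_mul_br_cyclic[of p y z v] by (simp add: algebra_simps add_eq_0_iff)
  then have "r \<odot> \<lbrace>z, p \<odot> \<lbrace>v, y\<rbrace>\<rbrace> + r \<odot> \<lbrace>y, p \<odot> \<lbrace>z, v\<rbrace>\<rbrace> = - (r \<odot> \<lbrace>v, p \<odot> \<lbrace>y, z\<rbrace>\<rbrace>)"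
    by (metis mul_add_right mul_minus_right)
  then show ?thesis
    unfolding mul_br_exchange by (simp add: algebra_simps)
qed

section \<open>The ternary bracket attached to a map\<close>

text \<open>
If \<open>\<lbrace>x, y\<rbrace> = x \<odot> \<delta> y - y \<odot> \<delta> x\<close> for a derivation \<open>\<delta>\<close>, this is the determinant with rows
\<open>(x, \<delta> x, d x)\<close>, \<open>(y, \<delta> y, d y)\<close>, \<open>(z, \<delta> z, d z)\<close>, which explains the name.
\<close>

definition wronskian :: "('a \<Rightarrow> 'a) \<Rightarrow> 'a \<Rightarrow> 'a \<Rightarrow> 'a \<Rightarrow> 'a" where
  "wronskian d x y z = d x \<odot> \<lbrace>y, z\<rbrace> + d y \<odot> \<lbrace>z, x\<rbrace> + d z \<odot> \<lbrace>x, y\<rbrace>"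

lemma wronskian_skew_12: "wronskian d x y z = - wronskian d y x z"
  using br_skew[of y z] br_skew[of z x] br_skew[of x y]
  by (simp add: wronskian_def mul_minus_right algebra_simps)

lemma wronskian_skew_23: "wronskian d x y z = - wronskian d x z y"
  using br_skew[of y z] br_skew[of z x] br_skew[of x y]
  by (simp add: wronskian_def mul_minus_right algebra_simps)

text \<open>
Commutativity of the product forces \<open>E a \<odot> b = E b \<odot> a\<close> for \<open>E = P - Q\<close>. Doubling the bracket of
\<open>E\<close> by the transposed Leibniz rule then gives brackets that cancel in pairs.
\<close>

lemma wronskian_cong_twist:
  assumes "\<And>a b. X (a \<odot> b) = P a \<odot> b + a \<odot> Q b"
  shows "wronskian P x y z = wronskian Q x y z"
proof -
  define E where "E a = P a - Q a" for a
  have E: "E a \<odot> b = E b \<odot> a" for a b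
  proof -
    have "P a \<odot> b + a \<odot> Q b = P b \<odot> a + b \<odot> Q a"
      using assms[of a b] assms[of b a] by (simp add: mul_commute)
    then show ?thesis
      by (simp add: E_def mul_diff_left mul_commute[of a] mul_commute[of b] algebra_simps)
  qed
  have "wronskian E x y z = 0"
  proof (rule two_torsion_free)
    have "wronskian E x y z + wronskian E x y z
        = (\<lbrace>E x \<odot> y, z\<rbrace> + \<lbrace>y, E x \<odot> z\<rbrace>) + (\<lbrace>E y \<odot> z, x\<rbrace> + \<lbrace>z, E y \<odot> x\<rbrace>) + (\<lbrace>E z \<odot> x, y\<rbrace> + \<lbrace>x, E z \<odot> y\<rbrace>)"
      unfolding leibniz[symmetric] wronskian_def by (simp add: add_ac)
    also have "\<dots> = 0"
      using br_skew[of y "E x \<odot> z"] br_skew[of z "E y \<odot> x"] br_skew[of x "E z \<odot> y"]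
        E[of x y] E[of y z] E[of z x] by simp
    finally show "wronskian E x y z + wronskian E x y z = 0" .
  qed
  then show ?thesis
    by (simp add: wronskian_def E_def mul_diff_left algebra_simps)
qed

text \<open>
The coefficients of \<open>e u\<close> and \<open>e v\<close> vanish by \<open>br_times_br_cyclic\<close>, while \<open>e x\<close>, \<open>e y\<close> and \<open>e z\<close>
occur symmetrically on the two sides.
\<close>

lemma second_order_cancels:
  fixes e :: "'a \<Rightarrow> 'a"
  defines "\<Phi> \<equiv> \<lambda>u v x y z. \<lbrace>u, v\<rbrace> \<odot> wronskian e x y z"
  shows "\<Phi> u v x y z = \<Phi> y z u v x - \<Phi> x z u v y + \<Phi> x y u v z"
proof -
  have K: "e a \<odot> (\<lbrace>b, x\<rbrace> \<odot> \<lbrace>y, z\<rbrace>) + e a \<odot> (\<lbrace>b, y\<rbrace> \<odot> \<lbrace>z, x\<rbrace>) + e a \<odot> (\<lbrace>b, z\<rbrace> \<odot> \<lbrace>x, y\<rbrace>) = 0" for a b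
    using arg_cong[OF br_times_br_cyclic[of b x y z], of "\<lambda>t. e a \<odot> t"]
    by (simp add: mul_add_right mul_zero_right)
  have "\<Phi> u v x y z - (\<Phi> y z u v x - \<Phi> x z u v y + \<Phi> x y u v z)
    = e v \<odot> (\<lbrace>u, x\<rbrace> \<odot> \<lbrace>y, z\<rbrace>) + e v \<odot> (\<lbrace>u, y\<rbrace> \<odot> \<lbrace>z, x\<rbrace>) + e v \<odot> (\<lbrace>u, z\<rbrace> \<odot> \<lbrace>x, y\<rbrace>)
    - (e u \<odot> (\<lbrace>v, x\<rbrace> \<odot> \<lbrace>y, z\<rbrace>) + e u \<odot> (\<lbrace>v, y\<rbrace> \<odot> \<lbrace>z, x\<rbrace>) + e u \<odot> (\<lbrace>v, z\<rbrace> \<odot> \<lbrace>x, y\<rbrace>))"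
    unfolding \<Phi>_def wronskian_def
    using br_skew[of x u] br_skew[of y u] br_skew[of z u] br_skew[of x z]
    by (simp add: distribs mul_ac algebra_simps)
  then show ?thesis
    unfolding K by simp
qed

text \<open>
Here \<open>W x y z\<close> is what remains of \<open>d (wronskian d x y z)\<close> for a derivation \<open>d\<close> without the terms
in which \<open>d\<close> acts twice on one letter. For each pair of letters, the terms with \<open>d\<close> on this pair
cancel among themselves, whatever the ten elements \<open>u\<close>, \<open>d u\<close>, and so on are: the pair \<open>u, v\<close> by
\<open>br_times_br_cyclic\<close>, the pairs of one of \<open>u, v\<close> and one of \<open>x, y, z\<close> by
\<open>mul_br_exchange_jacobi\<close>, and the pairs in \<open>x, y, z\<close> by \<open>mul_br_exchange\<close>. Thus \<open>d\<close> may be an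
arbitrary map.
\<close>

lemma first_order_cancels:
  fixes d :: "'a \<Rightarrow> 'a"
  defines "W \<equiv> \<lambda>x y z. d x \<odot> (\<lbrace>d y, z\<rbrace> + \<lbrace>y, d z\<rbrace>) + d y \<odot> (\<lbrace>d z, x\<rbrace> + \<lbrace>z, d x\<rbrace>)
      + d z \<odot> (\<lbrace>d x, y\<rbrace> + \<lbrace>x, d y\<rbrace>)"
  defines "\<Phi> \<equiv> \<lambda>u v x y z. d u \<odot> \<lbrace>v, wronskian d x y z\<rbrace> - d v \<odot> \<lbrace>u, wronskian d x y z\<rbrace>
      + \<lbrace>u, v\<rbrace> \<odot> W x y z"
  shows "\<Phi> u v x y z = \<Phi> y z u v x - \<Phi> x z u v y + \<Phi> x y u v z"
proof -
  have uv: "d u \<odot> (\<lbrace>d v, x\<rbrace> \<odot> \<lbrace>y, z\<rbrace>) + d u \<odot> (\<lbrace>d v, y\<rbrace> \<odot> \<lbrace>z, x\<rbrace>) + d u \<odot> (\<lbrace>d v, z\<rbrace> \<odot> \<lbrace>x, y\<rbrace>) = 0" for u v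
    using arg_cong[OF br_times_br_cyclic[of "d v" x y z], of "\<lambda>t. d u \<odot> t"]
    by (simp add: mul_add_right mul_zero_right)
  note ux = mul_br_exchange_jacobi[of "d u" v "d x" y z] mul_br_exchange_jacobi[of "d u" v "d y" z x]
    mul_br_exchange_jacobi[of "d u" v "d z" x y]
  note vx = mul_br_exchange_jacobi[of "d v" u "d x" y z] mul_br_exchange_jacobi[of "d v" u "d y" z x]
    mul_br_exchange_jacobi[of "d v" u "d z" x y]
  note xy = mul_br_exchange[of "\<lbrace>u, v\<rbrace>" "d x" "d y" z] mul_br_exchange[of "\<lbrace>u, v\<rbrace>" "d y" "d z" x]
    mul_br_exchange[of "\<lbrace>u, v\<rbrace>" "d z" "d x" y]
  have add: "a = b \<Longrightarrow> c = d \<Longrightarrow> a + c = b + d" and sub: "a = b \<Longrightarrow> c = d \<Longrightarrow> a - c = b - d" for a b c d :: 'a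
    by auto
  \<comment> \<open>One orientation for every bracket of letters, so that equal terms become syntactically equal.\<close>
  have sk: "\<lbrace>v, u\<rbrace> = - \<lbrace>u, v\<rbrace>" "\<lbrace>z, y\<rbrace> = - \<lbrace>y, z\<rbrace>" "\<lbrace>x, z\<rbrace> = - \<lbrace>z, x\<rbrace>" "\<lbrace>y, x\<rbrace> = - \<lbrace>x, y\<rbrace>"
     "\<lbrace>x, u\<rbrace> = - \<lbrace>u, x\<rbrace>" "\<lbrace>x, v\<rbrace> = - \<lbrace>v, x\<rbrace>" "\<lbrace>y, u\<rbrace> = - \<lbrace>u, y\<rbrace>" "\<lbrace>y, v\<rbrace> = - \<lbrace>v, y\<rbrace>"
     "\<lbrace>z, u\<rbrace> = - \<lbrace>u, z\<rbrace>" "\<lbrace>z, v\<rbrace> = - \<lbrace>v, z\<rbrace>"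
     "\<lbrace>u, d a\<rbrace> = - \<lbrace>d a, u\<rbrace>" "\<lbrace>v, d a\<rbrace> = - \<lbrace>d a, v\<rbrace>" "\<lbrace>x, d a\<rbrace> = - \<lbrace>d a, x\<rbrace>" "\<lbrace>y, d a\<rbrace> = - \<lbrace>d a, y\<rbrace>"
     "\<lbrace>z, d a\<rbrace> = - \<lbrace>d a, z\<rbrace>" for a by (rule br_skew)+
  show ?thesis
    using add[OF sub[OF uv[of v u] uv[of u v]]
      add[OF sub[OF add[OF add[OF ux(1,2)] ux(3)] add[OF add[OF vx(1,2)] vx(3)]]
        add[OF add[OF xy(1,2)] xy(3)]]]
    unfolding \<Phi>_def W_def wronskian_def
    by (simp only: distribs sk minus_minus mul_ac) (simp add: algebra_simps)
qed

end

section \<open>Sequences of quasi-derivations\<close>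

text \<open>
A derivation gives a constant sequence. In general, a map that fails to commute with the
automorphisms of an algebra comes back changed when it acts on a factor of a product; the index
counts these changes.
\<close>

locale quasi_derivation_sequence = transposed_poisson_ring +
  fixes S :: "nat \<Rightarrow> 'a \<Rightarrow> 'a"
  assumes S_add: "S n (a + b) = S n a + S n b"
    and S_mul: "S n (a \<odot> b) = S (Suc n) a \<odot> b + a \<odot> S (Suc n) b"
    and S_br: "S n \<lbrace>a, b\<rbrace> = \<lbrace>S (Suc n) a, b\<rbrace> + \<lbrace>a, S (Suc n) b\<rbrace>"
begin

text \<open>
Applying \<open>S n\<close> to the transposed Leibniz rule, and using the rule itself for the terms that
contain only \<open>S (n + 2)\<close>, yields \<open>2 F a \<odot> \<lbrace>b, c\<rbrace> = \<lbrace>F b, a \<odot> c\<rbrace> - \<lbrace>F c, a \<odot> b\<rbrace>\<close> for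
\<open>F = S (n + 1) - S (n + 2)\<close>. The right-hand side has cyclic sum zero.
\<close>

lemma wronskian_S_Suc: "wronskian (S (Suc n)) x y z = wronskian (S (Suc (Suc n))) x y z"
proof -
  let ?S1 = "S (Suc n)" and ?S2 = "S (Suc (Suc n))"
  have compare: "?S1 a \<odot> \<lbrace>b, c\<rbrace> + ?S1 a \<odot> \<lbrace>b, c\<rbrace> + (\<lbrace>?S2 b, a \<odot> c\<rbrace> - \<lbrace>?S2 c, a \<odot> b\<rbrace>)
      = ?S2 a \<odot> \<lbrace>b, c\<rbrace> + ?S2 a \<odot> \<lbrace>b, c\<rbrace> + (\<lbrace>?S1 b, a \<odot> c\<rbrace> - \<lbrace>?S1 c, a \<odot> b\<rbrace>)" for a b c
  proof -
    have "?S1 a \<odot> \<lbrace>b, c\<rbrace> + ?S1 a \<odot> \<lbrace>b, c\<rbrace> + (a \<odot> \<lbrace>?S2 b, c\<rbrace> + a \<odot> \<lbrace>?S2 b, c\<rbrace>)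
        + (a \<odot> \<lbrace>b, ?S2 c\<rbrace> + a \<odot> \<lbrace>b, ?S2 c\<rbrace>) = S n (a \<odot> \<lbrace>b, c\<rbrace> + a \<odot> \<lbrace>b, c\<rbrace>)"
      by (simp add: S_add S_mul S_br mul_add_right algebra_simps)
    also have "\<dots> = \<lbrace>?S2 a \<odot> b, c\<rbrace> + \<lbrace>b, ?S2 a \<odot> c\<rbrace> + \<lbrace>a \<odot> ?S2 b, c\<rbrace> + \<lbrace>b, a \<odot> ?S2 c\<rbrace>
        + \<lbrace>a \<odot> b, ?S1 c\<rbrace> + \<lbrace>?S1 b, a \<odot> c\<rbrace>"
      unfolding leibniz by (simp add: S_add S_mul S_br br_add_left br_add_right algebra_simps)
    finally show ?thesis
      unfolding leibniz[of a "?S2 b" c] leibniz[of a b "?S2 c"] leibniz[of "?S2 a" b c]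
      using br_skew[of "a \<odot> b" "?S1 c"] br_skew[of "a \<odot> b" "?S2 c"]
      by (simp add: algebra_simps)
  qed
  have add: "a = b \<Longrightarrow> c = d \<Longrightarrow> a + c = b + d" for a b c d :: 'a
    by auto
  show ?thesis
    unfolding wronskian_def
    by (rule double_cancel)
      (use add[OF add[OF compare[of x y z] compare[of y z x]] compare[of z x y]] in
        \<open>simp add: mul_commute algebra_simps\<close>)
qed

text \<open>
Evaluate \<open>S n\<close> on the two bracketings of \<open>a \<odot> b \<odot> c\<close>. An outer factor is hit by \<open>S (n + 1)\<close> in
one of them and by \<open>S (n + 2)\<close> in the other.
\<close>

lemma S_diff_mul_exchange:
  "(S (Suc n) a - S (Suc (Suc n)) a) \<odot> (b \<odot> c) = a \<odot> b \<odot> (S (Suc n) c - S (Suc (Suc n)) c)"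
proof -
  have "S n (a \<odot> b \<odot> c) = S n (a \<odot> (b \<odot> c))"
    by (simp add: mul_assoc)
  then show ?thesis
    unfolding S_mul by (simp add: distribs mul_assoc algebra_simps)
qed

text \<open>
The derivative of \<open>u\<close> has coefficient zero by \<open>mul_br_cyclic\<close>. Of the three copies of
\<open>u \<odot> wronskian x y z\<close>, one comes from the derivatives of products, with index \<open>n + 2\<close> in place
of \<open>n + 1\<close>, and two come from the transposed Leibniz rule.
\<close>

lemma wronskian_mul:
  "u \<odot> wronskian (S (Suc n)) x y z + u \<odot> wronskian (S (Suc n)) x y z + u \<odot> wronskian (S (Suc n)) x y z
   = wronskian (S (Suc n)) (u \<odot> x) y z + wronskian (S (Suc n)) x (u \<odot> y) z
     + wronskian (S (Suc n)) x y (u \<odot> z)" (is "?l = ?r")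
proof -
  let ?S1 = "S (Suc n)" and ?S2 = "S (Suc (Suc n))"
  have "?r = ?S1 (u \<odot> x) \<odot> \<lbrace>y, z\<rbrace> + ?S1 (u \<odot> y) \<odot> \<lbrace>z, x\<rbrace> + ?S1 (u \<odot> z) \<odot> \<lbrace>x, y\<rbrace>
     + ?S1 x \<odot> (\<lbrace>u \<odot> y, z\<rbrace> + \<lbrace>y, u \<odot> z\<rbrace>) + ?S1 y \<odot> (\<lbrace>u \<odot> z, x\<rbrace> + \<lbrace>z, u \<odot> x\<rbrace>)
     + ?S1 z \<odot> (\<lbrace>u \<odot> x, y\<rbrace> + \<lbrace>x, u \<odot> y\<rbrace>)"
    by (simp add: wronskian_def mul_add_right algebra_simps)
  also have "\<dots> = S (Suc (Suc n)) u \<odot> (x \<odot> \<lbrace>y, z\<rbrace> + y \<odot> \<lbrace>z, x\<rbrace> + z \<odot> \<lbrace>x, y\<rbrace>)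
     + u \<odot> wronskian ?S2 x y z + u \<odot> wronskian ?S1 x y z + u \<odot> wronskian ?S1 x y z"
    unfolding leibniz[symmetric] S_mul wronskian_def
    by (simp add: distribs mul_ac algebra_simps)
  finally show ?thesis
    by (simp add: mul_br_cyclic mul_zero_right wronskian_S_Suc[of n])
qed

text \<open>
Applying \<open>d = S (n + 2)\<close> to a factor \<open>\<lbrace>y, z\<rbrace>\<close> of the Wronskian of \<open>d\<close> involves \<open>S (n + 3) \<lbrace>y, z\<rbrace>\<close>, but
\<open>first_order_cancels\<close> needs \<open>\<lbrace>d y, z\<rbrace> + \<lbrace>y, d z\<rbrace> = S (n + 1) \<lbrace>y, z\<rbrace>\<close>. After multiplication by
\<open>\<lbrace>u, v\<rbrace>\<close>, the exchange law moves the difference \<open>S (n + 3) - S (n + 1)\<close> from \<open>\<lbrace>y, z\<rbrace>\<close> to \<open>d x\<close>, where it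
only contributes to the map \<open>e\<close>.
\<close>

lemma S_wronskian:
  fixes n
  defines "d \<equiv> S (Suc (Suc n))"
  defines "e \<equiv> \<lambda>x. S (Suc (Suc (Suc n))) (d x) + (S (Suc (Suc (Suc n))) (d x) - S (Suc n) (d x))"
  shows "\<lbrace>u, v\<rbrace> \<odot> d (wronskian d x y z) = \<lbrace>u, v\<rbrace> \<odot> (d x \<odot> (\<lbrace>d y, z\<rbrace> + \<lbrace>y, d z\<rbrace>)
     + d y \<odot> (\<lbrace>d z, x\<rbrace> + \<lbrace>z, d x\<rbrace>) + d z \<odot> (\<lbrace>d x, y\<rbrace> + \<lbrace>x, d y\<rbrace>))
     + \<lbrace>u, v\<rbrace> \<odot> wronskian e x y z"
proof -
  let ?S1 = "S (Suc n)" and ?S3 = "S (Suc (Suc (Suc n)))"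
  have G: "(?S3 a - ?S1 a) \<odot> (b \<odot> c) = a \<odot> b \<odot> (?S3 c - ?S1 c)" for a b c
    using arg_cong2[OF S_diff_mul_exchange[of n a b c] S_diff_mul_exchange[of "Suc n" a b c], of "(+)"]
    unfolding mul_add_left[symmetric] mul_add_right[symmetric]
    by (simp add: distribs algebra_simps)
  have d_term: "\<lbrace>u, v\<rbrace> \<odot> d (d a \<odot> \<lbrace>b, c\<rbrace>)
      = \<lbrace>u, v\<rbrace> \<odot> (d a \<odot> (\<lbrace>d b, c\<rbrace> + \<lbrace>b, d c\<rbrace>)) + \<lbrace>u, v\<rbrace> \<odot> (e a \<odot> \<lbrace>b, c\<rbrace>)" for a b c
  proof -
    have "\<lbrace>u, v\<rbrace> \<odot> d (d a \<odot> \<lbrace>b, c\<rbrace>)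
        = \<lbrace>u, v\<rbrace> \<odot> (?S3 (d a) \<odot> \<lbrace>b, c\<rbrace>) + \<lbrace>u, v\<rbrace> \<odot> (d a \<odot> ?S1 \<lbrace>b, c\<rbrace>)
          + d a \<odot> \<lbrace>u, v\<rbrace> \<odot> (?S3 \<lbrace>b, c\<rbrace> - ?S1 \<lbrace>b, c\<rbrace>)"
      unfolding d_def by (simp add: S_mul distribs mul_ac)
    also have "\<dots> = \<lbrace>u, v\<rbrace> \<odot> (d a \<odot> ?S1 \<lbrace>b, c\<rbrace>) + \<lbrace>u, v\<rbrace> \<odot> (e a \<odot> \<lbrace>b, c\<rbrace>)"
      unfolding G[symmetric] e_def by (simp add: distribs mul_ac algebra_simps)
    finally show ?thesis
      by (simp add: S_br d_def)
  qed
  have "d (wronskian d x y z) = d (d x \<odot> \<lbrace>y, z\<rbrace>) + d (d y \<odot> \<lbrace>z, x\<rbrace>) + d (d z \<odot> \<lbrace>x, y\<rbrace>)"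
    unfolding d_def wronskian_def S_add ..
  then show ?thesis
    by (simp only: mul_add_right d_term) (simp add: wronskian_def mul_add_right algebra_simps)
qed

text \<open>
The 3-Lie identity. The Wronskian is computed with \<open>S (n + 2)\<close>, the first index for which
\<open>S_wronskian\<close> applies; \<open>wronskian_S_Suc\<close> makes this the same ternary bracket.
\<close>

lemma wronskian_filippov:
  fixes n
  defines "T \<equiv> wronskian (S (Suc n))"
  shows "T u v (T x y z) = T y z (T u v x) - T x z (T u v y) + T x y (T u v z)"
proof -
  define d where "d = S (Suc (Suc n))"
  define e where "e x = S (Suc (Suc (Suc n))) (d x) + (S (Suc (Suc (Suc n))) (d x) - S (Suc n) (d x))" for x
  have T: "T = wronskian d"
    unfolding T_def d_def by (intro ext wronskian_S_Suc)
  have expand: "T u v (T x y z) =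
      (d u \<odot> \<lbrace>v, wronskian d x y z\<rbrace> - d v \<odot> \<lbrace>u, wronskian d x y z\<rbrace>
      + \<lbrace>u, v\<rbrace> \<odot> (d x \<odot> (\<lbrace>d y, z\<rbrace> + \<lbrace>y, d z\<rbrace>) + d y \<odot> (\<lbrace>d z, x\<rbrace> + \<lbrace>z, d x\<rbrace>)
      + d z \<odot> (\<lbrace>d x, y\<rbrace> + \<lbrace>x, d y\<rbrace>)))
      + \<lbrace>u, v\<rbrace> \<odot> wronskian e x y z" for u v x y z
    using S_wronskian[of u v n x y z] br_skew[of "wronskian d x y z" u]
    unfolding T wronskian_def[of d u] d_def[symmetric] e_def[abs_def]
    by (simp add: mul_minus_right mul_commute[of _ "\<lbrace>u, v\<rbrace>"] add.assoc)
  show ?thesis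
    unfolding expand first_order_cancels[of d u v x y z] second_order_cancels[of u v e x y z]
    by (simp add: algebra_simps)
qed

end

section \<open>Untwisting a regular transposed BiHom-Poisson algebra\<close>

locale regular_transposed_bihom_poisson_derivation =
  regular_transposed_bihom_poisson_algebra scale pr bk \<alpha> \<beta>
  for scale :: "'k::field_char_0 \<Rightarrow> 'a::ab_group_add \<Rightarrow> 'a" and pr bk \<alpha> \<beta> +
  fixes D :: "'a \<Rightarrow> 'a"
  assumes derivation_pr: "derivation_of scale pr D"
    and derivation_bk: "derivation_of scale bk D"
begin

abbreviation (input) \<alpha>i where "\<alpha>i \<equiv> inv \<alpha>"
abbreviation (input) \<beta>i where "\<beta>i \<equiv> inv \<beta>"

lemma inverses [simp]: "\<alpha> (\<alpha>i x) = x" "\<alpha>i (\<alpha> x) = x" "\<beta> (\<beta>i x) = x" "\<beta>i (\<beta> x) = x"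
  using bij_alpha bij_beta by (simp_all add: bij_is_surj surj_f_inv_f bij_is_inj)

lemma commute: "\<beta> (\<alpha> x) = \<alpha> (\<beta> x)" "\<beta> (\<alpha>i x) = \<alpha>i (\<beta> x)" "\<beta>i (\<alpha> x) = \<alpha> (\<beta>i x)" "\<beta>i (\<alpha>i x) = \<alpha>i (\<beta>i x)"
proof -
  show *: "\<beta> (\<alpha> x) = \<alpha> (\<beta> x)" for x
    using alpha_beta_commute by (metis comp_apply)
  show "\<beta> (\<alpha>i x) = \<alpha>i (\<beta> x)" for x
    by (metis * inverses(1,2))
  show "\<beta>i (\<alpha> x) = \<alpha> (\<beta>i x)" for x
    by (metis * inverses(3,4))
  show "\<beta>i (\<alpha>i x) = \<alpha>i (\<beta>i x)"
    by (metis * inverses)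
qed

lemma linear_maps:
  "\<alpha> (x + y) = \<alpha> x + \<alpha> y" "\<beta> (x + y) = \<beta> x + \<beta> y" "D (x + y) = D x + D y"
  "\<alpha> (scale c x) = scale c (\<alpha> x)" "\<beta> (scale c x) = scale c (\<beta> x)" "D (scale c x) = scale c (D x)"
proof -
  interpret \<alpha>: Vector_Spaces.linear scale scale \<alpha> by (rule linear_alpha)
  interpret \<beta>: Vector_Spaces.linear scale scale \<beta> by (rule linear_beta)
  interpret D: Vector_Spaces.linear scale scale D using derivation_pr by (simp add: derivation_of_def)
  show "\<alpha> (x + y) = \<alpha> x + \<alpha> y" "\<beta> (x + y) = \<beta> x + \<beta> y" "D (x + y) = D x + D y"
    "\<alpha> (scale c x) = scale c (\<alpha> x)" "\<beta> (scale c x) = scale c (\<beta> x)" "D (scale c x) = scale c (D x)"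
    by (simp_all add: \<alpha>.add \<beta>.add D.add \<alpha>.scale \<beta>.scale D.scale)
qed

lemma linear_inverses:
  "\<alpha>i (x + y) = \<alpha>i x + \<alpha>i y" "\<beta>i (x + y) = \<beta>i x + \<beta>i y"
  "\<alpha>i (scale c x) = scale c (\<alpha>i x)" "\<beta>i (scale c x) = scale c (\<beta>i x)"
  by (metis inverses linear_maps)+

lemma bilinear:
  "pr (x + y) z = pr x z + pr y z" "pr z (x + y) = pr z x + pr z y"
  "bk (x + y) z = bk x z + bk y z" "bk z (x + y) = bk z x + bk z y"
  "pr (scale c x) z = scale c (pr x z)" "pr z (scale c x) = scale c (pr z x)"
  "bk (scale c x) z = scale c (bk x z)" "bk z (scale c x) = scale c (bk z x)"
  using bilinear_mul bilinear_br unfolding bilinear_map_def Vector_Spaces.linear_iff by auto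

lemma double_zero: "(x::'a) + x = 0 \<Longrightarrow> x = 0"
  using scale_left_distrib[of 1 1 x] scale_eq_0_iff[of 2 x] by simp

lemma inverse_products:
  "\<alpha>i (pr x y) = pr (\<alpha>i x) (\<alpha>i y)" "\<beta>i (pr x y) = pr (\<beta>i x) (\<beta>i y)"
  "\<alpha>i (bk x y) = bk (\<alpha>i x) (\<alpha>i y)" "\<beta>i (bk x y) = bk (\<beta>i x) (\<beta>i y)"
  by (metis inverses alpha_mul beta_mul alpha_br beta_br)+

text \<open>
The untwisted product and bracket, of which \<open>pr\<close> and \<open>bk\<close> are the twists by \<open>\<alpha>\<close> and \<open>\<beta>\<close>.
\<close>

definition pr0 where "pr0 x y = pr (\<alpha>i x) (\<beta>i y)"
definition bk0 where "bk0 x y = bk (\<alpha>i x) (\<beta>i y)"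

lemma pr_eq_pr0: "pr x y = pr0 (\<alpha> x) (\<beta> y)"
  by (simp add: pr0_def)

lemma bk_eq_bk0: "bk x y = bk0 (\<alpha> x) (\<beta> y)"
  by (simp add: bk0_def)

lemma automorphisms:
  "\<alpha> (pr0 x y) = pr0 (\<alpha> x) (\<alpha> y)" "\<beta> (pr0 x y) = pr0 (\<beta> x) (\<beta> y)"
  "\<alpha> (bk0 x y) = bk0 (\<alpha> x) (\<alpha> y)" "\<beta> (bk0 x y) = bk0 (\<beta> x) (\<beta> y)"
  "\<alpha>i (pr0 x y) = pr0 (\<alpha>i x) (\<alpha>i y)" "\<beta>i (pr0 x y) = pr0 (\<beta>i x) (\<beta>i y)"
  "\<alpha>i (bk0 x y) = bk0 (\<alpha>i x) (\<alpha>i y)" "\<beta>i (bk0 x y) = bk0 (\<beta>i x) (\<beta>i y)"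
  by (simp_all add: pr0_def bk0_def alpha_mul beta_mul alpha_br beta_br inverse_products commute)

sublocale untwisted: transposed_poisson_ring pr0 bk0
proof
  fix x y z :: 'a
  show "x + x = 0 \<Longrightarrow> x = 0" by (rule double_zero)
  show "pr0 (x + y) z = pr0 x z + pr0 y z" "bk0 (x + y) z = bk0 x z + bk0 y z"
    by (simp_all add: pr0_def bk0_def bilinear linear_inverses)
  show "pr0 x y = pr0 y x"
    using bihom_comm[of "\<alpha>i (\<beta>i x)" "\<alpha>i (\<beta>i y)"] by (simp add: pr0_def commute)
  show "bk0 x y = - bk0 y x"
    using bihom_skew[of "\<alpha>i (\<beta>i x)" "\<alpha>i (\<beta>i y)"] by (simp add: bk0_def commute)
  show "pr0 (pr0 x y) z = pr0 x (pr0 y z)"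
    using bihom_assoc[of "\<alpha>i (\<alpha>i x)" "\<alpha>i (\<beta>i y)" "\<beta>i (\<beta>i z)"]
    by (simp add: pr0_def inverse_products commute)
  show "bk0 (bk0 x y) z + bk0 (bk0 y z) x + bk0 (bk0 z x) y = 0"
    using bihom_jacobi[of "\<alpha>i (\<alpha>i (\<beta>i x))" "\<alpha>i (\<alpha>i (\<beta>i y))" "\<alpha>i (\<alpha>i (\<beta>i z))"]
    by (simp add: bk0_def inverse_products commute)
  show "pr0 x (bk0 y z) + pr0 x (bk0 y z) = bk0 (pr0 x y) z + bk0 y (pr0 x z)"
    using transposed_leibniz[of "\<alpha>i (\<alpha>i (\<beta>i x))" "\<alpha>i (\<beta>i y)" "\<beta>i (\<beta>i z)"]
      scale_left_distrib[of 1 1 "pr0 x (bk0 y z)"]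
    by (simp add: pr0_def bk0_def inverse_products commute)
qed

text \<open>
Averaging the two conjugates makes the twisted Leibniz rule symmetric in its two factors.
\<close>

fun S :: "nat \<Rightarrow> 'a \<Rightarrow> 'a" where
  "S 0 x = D x"
| "S (Suc n) x = scale (1/2) (\<alpha> (S n (\<alpha>i x)) + \<beta> (S n (\<beta>i x)))"

lemma S_linear: "S n (x + y) = S n x + S n y" "S n (scale c x) = scale c (S n x)"
  by (induction n arbitrary: x y)
    (simp_all add: linear_maps linear_inverses scale_right_distrib ac_simps)

lemma S_Suc_double: "S (Suc n) x + S (Suc n) x = \<alpha> (S n (\<alpha>i x)) + \<beta> (S n (\<beta>i x))"
  using scale_left_distrib[of "1/2" "1/2"] by simp

text \<open>
For \<open>n = 0\<close> this is the derivation property of \<open>D\<close> in terms of the untwisted products. It passes from a map to its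
conjugates by \<open>\<alpha>\<close> and by \<open>\<beta>\<close>, because these are commuting automorphisms, hence to the average.
\<close>

lemma S_twisted_leibniz:
  "S n (pr0 a b) = pr0 (\<alpha> (S n (\<alpha>i a))) b + pr0 a (\<beta> (S n (\<beta>i b)))"
  "S n (bk0 a b) = bk0 (\<alpha> (S n (\<alpha>i a))) b + bk0 a (\<beta> (S n (\<beta>i b)))"
proof (induction n arbitrary: a b)
  case 0
  {
    case 1
    show ?case
      using derivation_pr by (simp add: derivation_of_def pr0_def commute)
  next
    case 2
    show ?case
      using derivation_bk by (simp add: derivation_of_def bk0_def commute)
  }
next
  case (Suc n)
  have S_alpha: "\<alpha> (S (Suc n) x) + \<alpha> (S (Suc n) x) = \<alpha> (\<alpha> (S n (\<alpha>i x))) + \<alpha> (\<beta> (S n (\<beta>i x)))"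
    and S_beta: "\<beta> (S (Suc n) x) + \<beta> (S (Suc n) x) = \<alpha> (\<beta> (S n (\<alpha>i x))) + \<beta> (\<beta> (S n (\<beta>i x)))" for x
    unfolding linear_maps(1,2)[symmetric] S_Suc_double
    by (simp_all only: linear_maps(1,2) commute)
  {
    case 1
    show ?case
    proof (rule untwisted.double_cancel)
      show "S (Suc n) (pr0 a b) + S (Suc n) (pr0 a b) = 
        pr0 (\<alpha> (S (Suc n) (\<alpha>i a))) b + pr0 a (\<beta> (S (Suc n) (\<beta>i b)))
        + (pr0 (\<alpha> (S (Suc n) (\<alpha>i a))) b + pr0 a (\<beta> (S (Suc n) (\<beta>i b))))"
        using arg_cong[OF S_alpha[of "\<alpha>i a"], of "\<lambda>t. pr0 t b"] arg_cong[OF S_beta[of "\<beta>i b"], of "pr0 a"]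
        unfolding S_Suc_double automorphisms Suc
        by (simp del: S.simps add: automorphisms linear_maps untwisted.distribs commute algebra_simps)
    qed
  next
    case 2
    show ?case
    proof (rule untwisted.double_cancel)
      show "S (Suc n) (bk0 a b) + S (Suc n) (bk0 a b) = 
        bk0 (\<alpha> (S (Suc n) (\<alpha>i a))) b + bk0 a (\<beta> (S (Suc n) (\<beta>i b)))
        + (bk0 (\<alpha> (S (Suc n) (\<alpha>i a))) b + bk0 a (\<beta> (S (Suc n) (\<beta>i b))))"
        using arg_cong[OF S_alpha[of "\<alpha>i a"], of "\<lambda>t. bk0 t b"] arg_cong[OF S_beta[of "\<beta>i b"], of "bk0 a"]
        unfolding S_Suc_double automorphisms Suc
        by (simp del: S.simps add: automorphisms linear_maps untwisted.distribs commute algebra_simps)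
    qed
  }
qed

sublocale seq: quasi_derivation_sequence pr0 bk0 S
proof
  fix n a b
  show "S n (a + b) = S n a + S n b"
    by (rule S_linear)
  let ?A = "\<lambda>x. \<alpha> (S n (\<alpha>i x))" and ?B = "\<lambda>x. \<beta> (S n (\<beta>i x))"
  \<comment> \<open>Add the twisted Leibniz rules for both orders of the factors.\<close>
  show "S n (pr0 a b) = pr0 (S (Suc n) a) b + pr0 a (S (Suc n) b)"
  proof (rule untwisted.double_cancel)
    have "S n (pr0 a b) + S n (pr0 a b) = S n (pr0 a b) + S n (pr0 b a)"
      by (simp add: untwisted.mul_commute)
    also have "\<dots> = pr0 (?A a + ?B a) b + pr0 a (?A b + ?B b)"
      unfolding S_twisted_leibniz
      by (simp add: untwisted.distribs untwisted.mul_commute[of b] untwisted.mul_commute[of _ a] ac_simps)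
    finally show "S n (pr0 a b) + S n (pr0 a b)
        = pr0 (S (Suc n) a) b + pr0 a (S (Suc n) b) + (pr0 (S (Suc n) a) b + pr0 a (S (Suc n) b))"
      unfolding S_Suc_double[symmetric] by (simp only: untwisted.distribs ac_simps)
  qed
  show "S n (bk0 a b) = bk0 (S (Suc n) a) b + bk0 a (S (Suc n) b)"
  proof (rule untwisted.double_cancel)
    have "S n (bk0 a b) + S n (bk0 b a) = 0"
      using S_linear(1)[of n "bk0 a b" "bk0 b a"] S_linear(2)[of n 0 0] untwisted.br_skew[of a b] by simp
    then have "S n (bk0 a b) + S n (bk0 a b) = S n (bk0 a b) - S n (bk0 b a)"
      by (simp add: add_eq_0_iff)
    also have "\<dots> = bk0 (?A a + ?B a) b + bk0 a (?A b + ?B b)"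
      unfolding S_twisted_leibniz
      using untwisted.br_skew[of "?A b" a] untwisted.br_skew[of b "?B a"]
      by (simp add: untwisted.distribs algebra_simps)
    finally show "S n (bk0 a b) + S n (bk0 a b)
        = bk0 (S (Suc n) a) b + bk0 a (S (Suc n) b) + (bk0 (S (Suc n) a) b + bk0 a (S (Suc n) b))"
      unfolding S_Suc_double[symmetric] by (simp only: untwisted.distribs ac_simps)
  qed
qed

definition bracket3 where "bracket3 = untwisted.wronskian (S 1)"

lemma wronskian_twists:
  "untwisted.wronskian (\<lambda>x. \<alpha> (S n (\<alpha>i x))) x y z = untwisted.wronskian (S (Suc n)) x y z"
  "untwisted.wronskian (\<lambda>x. \<beta> (S n (\<beta>i x))) x y z = untwisted.wronskian (S (Suc n)) x y z"
proof -
  let ?A = "\<lambda>x. \<alpha> (S n (\<alpha>i x))" and ?B = "\<lambda>x. \<beta> (S n (\<beta>i x))"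
  have AB: "untwisted.wronskian ?A x y z = untwisted.wronskian ?B x y z"
    by (rule untwisted.wronskian_cong_twist[OF S_twisted_leibniz(1)])
  have "untwisted.wronskian (S (Suc n)) x y z + untwisted.wronskian (S (Suc n)) x y z
      = untwisted.wronskian (\<lambda>x. S (Suc n) x + S (Suc n) x) x y z"
    by (simp only: untwisted.wronskian_def untwisted.mul_add_left ac_simps)
  also have "\<dots> = untwisted.wronskian ?A x y z + untwisted.wronskian ?B x y z"
    unfolding S_Suc_double by (simp only: untwisted.wronskian_def untwisted.mul_add_left ac_simps)
  finally show B: "untwisted.wronskian ?B x y z = untwisted.wronskian (S (Suc n)) x y z"
    unfolding AB by (rule untwisted.double_cancel[symmetric])
  show "untwisted.wronskian ?A x y z = untwisted.wronskian (S (Suc n)) x y z"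
    using AB B by simp
qed

text \<open>
An automorphism carries the Wronskian of \<open>S 1\<close> to that of its conjugate, which has the
Wronskian of \<open>S 2\<close>, hence that of \<open>S 1\<close>.
\<close>

lemma bracket3_invariant: "\<alpha> (bracket3 x y z) = bracket3 (\<alpha> x) (\<alpha> y) (\<alpha> z)" "\<beta> (bracket3 x y z) = bracket3 (\<beta> x) (\<beta> y) (\<beta> z)"
proof -
  have "untwisted.wronskian (S (Suc 1)) = untwisted.wronskian (S 1)"
    unfolding One_nat_def by (intro ext seq.wronskian_S_Suc[symmetric])
  moreover have "\<alpha> (untwisted.wronskian (S 1) x y z)
      = untwisted.wronskian (\<lambda>x. \<alpha> (S 1 (\<alpha>i x))) (\<alpha> x) (\<alpha> y) (\<alpha> z)"
    "\<beta> (untwisted.wronskian (S 1) x y z)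
      = untwisted.wronskian (\<lambda>x. \<beta> (S 1 (\<beta>i x))) (\<beta> x) (\<beta> y) (\<beta> z)"
    by (simp_all del: S.simps add: untwisted.wronskian_def linear_maps automorphisms)
  ultimately show "\<alpha> (bracket3 x y z) = bracket3 (\<alpha> x) (\<alpha> y) (\<alpha> z)" "\<beta> (bracket3 x y z) = bracket3 (\<beta> x) (\<beta> y) (\<beta> z)"
    unfolding bracket3_def by (simp_all only: wronskian_twists)
qed

definition tbr where
  "tbr x y z = pr (D x) (bk (\<beta>i y) (\<beta>i z)) + pr (D y) (bk (\<alpha>i z) (\<alpha> (\<beta>i (\<beta>i x))))
    + pr (D (\<alpha>i (\<beta> z))) (bk (\<beta>i x) (\<alpha> (\<beta>i (\<beta>i y))))"

text \<open>
Untwisting the three summands gives the Wronskian of \<open>\<alpha> D \<alpha>\<inverse>\<close>.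
\<close>

lemma tbr_eq_bracket3: "tbr x y z = bracket3 (\<alpha> x) (\<alpha> y) (\<beta> z)"
proof -
  have "tbr x y z = untwisted.wronskian (\<lambda>x. \<alpha> (S 0 (\<alpha>i x))) (\<alpha> x) (\<alpha> y) (\<beta> z)"
    by (simp add: tbr_def untwisted.wronskian_def pr_eq_pr0 bk_eq_bk0 automorphisms commute)
  then show ?thesis
    by (simp only: wronskian_twists bracket3_def One_nat_def)
qed

lemma transposed_three_lie: "transposed_bihom_poisson_three_lie_algebra scale pr tbr \<alpha> \<beta>"
proof
  show "trilinear_map scale tbr"
    unfolding trilinear_map_def Vector_Spaces.linear_iff tbr_def
    by (simp add: bilinear linear_maps linear_inverses vector_space_axioms scale_right_distrib)
  fix x y z u v
  show "\<alpha> (tbr x y z) = tbr (\<alpha> x) (\<alpha> y) (\<alpha> z)" "\<beta> (tbr x y z) = tbr (\<beta> x) (\<beta> y) (\<beta> z)"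
    unfolding tbr_eq_bracket3 by (simp_all add: bracket3_invariant commute)
  show "tbr (\<beta> x) (\<beta> y) (\<alpha> z) = - tbr (\<beta> y) (\<beta> x) (\<alpha> z)"
    unfolding tbr_eq_bracket3 bracket3_def by (rule untwisted.wronskian_skew_12)
  show "tbr (\<beta> x) (\<beta> y) (\<alpha> z) = - tbr (\<beta> x) (\<beta> z) (\<alpha> y)"
    unfolding tbr_eq_bracket3 unfolding bracket3_def commute by (rule untwisted.wronskian_skew_23)
  show "tbr (\<beta> (\<beta> u)) (\<beta> (\<beta> v)) (tbr (\<beta> x) (\<beta> y) (\<alpha> z))
       = tbr (\<beta> (\<beta> y)) (\<beta> (\<beta> z)) (tbr (\<beta> u) (\<beta> v) (\<alpha> x))
         - tbr (\<beta> (\<beta> x)) (\<beta> (\<beta> z)) (tbr (\<beta> u) (\<beta> v) (\<alpha> y))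
         + tbr (\<beta> (\<beta> x)) (\<beta> (\<beta> y)) (tbr (\<beta> u) (\<beta> v) (\<alpha> z))"
    unfolding tbr_eq_bracket3 unfolding bracket3_invariant commute
    unfolding bracket3_def One_nat_def by (rule seq.wronskian_filippov)
  have triple: "scale 3 w = w + w + w" for w
    using scale_left_distrib[of 2 1 w] scale_left_distrib[of 1 1 w] by simp
  show "scale 3 (pr (\<alpha> (\<beta> u)) (tbr x y z))
     = tbr (pr (\<beta> u) x) (\<beta> y) (\<beta> z) + tbr (\<beta> x) (pr (\<beta> u) y) (\<beta> z)
       + tbr (\<beta> x) (\<beta> y) (pr (\<alpha> u) z)"
    unfolding tbr_eq_bracket3
    unfolding triple pr_eq_pr0[of "\<alpha> (\<beta> u)"] pr_eq_pr0[of "\<beta> u"] pr_eq_pr0[of "\<alpha> u"]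
      bracket3_invariant commute automorphisms
    unfolding bracket3_def One_nat_def by (rule seq.wronskian_mul)
qed

end

theorem proposition3p16:
  fixes scale :: "'k::field_char_0 \<Rightarrow> 'a::ab_group_add \<Rightarrow> 'a"
    and mul br :: "'a \<Rightarrow> 'a \<Rightarrow> 'a"
    and \<alpha> \<beta> D :: "'a \<Rightarrow> 'a"
  assumes "regular_transposed_bihom_poisson_algebra scale mul br \<alpha> \<beta>"
    and "derivation_of scale mul D"
    and "derivation_of scale br D"
  shows "transposed_bihom_poisson_three_lie_algebra scale mul
    (\<lambda>x y z. mul (D x) (br (inv \<beta> y) (inv \<beta> z))
           + mul (D y) (br (inv \<alpha> z) (\<alpha> (inv \<beta> (inv \<beta> x))))
           + mul (D (inv \<alpha> (\<beta> z))) (br (inv \<beta> x) (\<alpha> (inv \<beta> (inv \<beta> y)))))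
    \<alpha> \<beta>"
proof -
  interpret regular_transposed_bihom_poisson_derivation scale mul br \<alpha> \<beta> D
    by (intro regular_transposed_bihom_poisson_derivation.intro
        regular_transposed_bihom_poisson_derivation_axioms.intro assms)
  show ?thesis
    using transposed_three_lie unfolding tbr_def[abs_def] .
qed

end
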